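(* Let $X_1,X_2,\ldots$ be i.i.d. real random variables with common distribution function $F(x)=\mathsf P(X_1<x)$, let $H_\tau$ be an extreme value distribution function, and assume $F\in\max\text{-}DA(H_\tau)$. Let $n\in\mathbb N$, $p\in[0,1]$, $\lambda=np$, and let $B_{n,p}$ be a random variable with the binomial distribution with parameters $n$ and $p$, independent of the sequence $X_1,X_2,\ldots$. Let the numbers $a\in\mathbb R$, $b>0$, $x\in\mathbb R$ and $p$ satisfy $H_\tau(x)>0$ and $p\bigl(1-F(a+bx)\bigr)\le\frac12$. Then $$\Big|\mathsf P\Big(\max_{1\le i\le B_{n,p}}X_i<a+bx\Big)-H_\tau(x)\Big|\le H_\tau(x)\bigl[r_{1,n}^*(x)+r_{2,n}^*(x)+r_{1,n}^*(x)r_{2,n}^*(x)\bigr],$$ where $$r_{1,n}^*(x)=\frac{2\lambda^2\bigl(1-F(a+bx)\bigr)^2}{n}+\frac{2\lambda^4\bigl(1-F(a+bx)\bigr)^4}{n^2(1-q)},$$ $$r_{2,n}^*(x)=\bigl|\lambda\bigl(1-F(a+bx)\bigr)+\log H_\tau(x)\bigr|+\frac{\bigl[\lambda\bigl(1-F(a+bx)\bigr)+\log H_\tau(x)\bigr]^2}{2(1-s)},$$ and $q<1$ and $s<1$ are arbitrary numbers satisfying the inequalities $$\frac{2\lambda^2\bigl(1-F(a+bx)\bigr)^2}{3n}\le q\quad\text{and}\quad\bigl|\lambda\bigl(1-F(a+bx)\bigr)+\log H_\tau(x)\bigr|\le 3s.$$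
   Context: Distribution functions are left-continuous: $F(x)=\mathsf P(X<x)$. Convention: $\max_{1\le i\le N}X_i=-\infty$ if $N=0$. Extreme value distribution functions: up to location and scale parameters, $H_\tau$ ($\tau\in\mathbb R$) is $\exp\{-(1+\tau x)^{-1/\tau}\}$ where $1+\tau x>0$ (for $\tau=0$: $\exp\{-e^{-x}\}$, $x\in\mathbb R$), extended by $0$ when $\tau>0$ and $1+\tau x\le 0$, and by $1$ when $\tau<0$ and $1+\tau x\le0$. Equivalently, with $\gamma=1/|\tau|$ when $\tau\ne0$, it is up to location and scale one of: $\exp\{-x^{-\gamma}\}$ for $x>0$ and $0$ for $x\le0$ ($\tau>0$); $\exp\{-|x|^\gamma\}$ for $x<0$ and $1$ for $x\ge0$ ($\tau<0$); $\exp\{-e^{-x}\}$ ($\tau=0$). $F\in\max\text{-}DA(H_\tau)$ means that there are sequences of centering constants and positive normalizing constants such that the distribution functions of the linearly normalized maxima $\max_{1\le i\le n}X_i$ converge weakly to $H_\tau$. *)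

theory Defs
  imports "HOL-Probability.Probability"
begin

text \<open>Distribution functions are left-continuous here, unlike the library's \<^const>\<open>cdf\<close>.\<close>

definition left_df :: "'a measure \<Rightarrow> ('a \<Rightarrow> real) \<Rightarrow> real \<Rightarrow> real" where
  "left_df M Y x = measure M {\<omega> \<in> space M. Y \<omega> < x}"

text \<open>The sequence is indexed by the positive natural numbers; \<open>X 0\<close> plays no role.\<close>

definition iid_with_df :: "'a measure \<Rightarrow> (nat \<Rightarrow> 'a \<Rightarrow> real) \<Rightarrow> (real \<Rightarrow> real) \<Rightarrow> bool" where
  "iid_with_df M X F \<longleftrightarrow>
     prob_space M \<and>
     prob_space.indep_vars M (\<lambda>_. borel) X {1..} \<and>
     (\<forall>i\<ge>1. left_df M (X i) = F)"

text \<open>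
  The library's \<open>indep_var\<close> requires both variables to have the same value type, so independence
  of an integer variable and a whole sequence is stated for the generated \<open>\<sigma>\<close>-algebras.
\<close>

definition indep_of_seq :: "'a measure \<Rightarrow> (nat \<Rightarrow> 'a \<Rightarrow> real) \<Rightarrow> ('a \<Rightarrow> nat) \<Rightarrow> bool" where
  "indep_of_seq M X B \<longleftrightarrow>
     prob_space.indep_set M
       (sets (vimage_algebra (space M) (\<lambda>\<omega>. \<lambda>i\<in>{1..}. X i \<omega>) (PiM {1..} (\<lambda>_. borel))))
       (sets (vimage_algebra (space M) B (count_space UNIV)))"

definition max_upto :: "(nat \<Rightarrow> real) \<Rightarrow> nat \<Rightarrow> ereal" where
  "max_upto u N = (if N = 0 then - \<infinity> else ereal (Max (u ` {1..N})))"

definition std_evd :: "real \<Rightarrow> real \<Rightarrow> real" where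
  "std_evd \<tau> x =
     (if \<tau> = 0 then exp (- exp (- x))
      else if 1 + \<tau> * x > 0 then exp (- ((1 + \<tau> * x) powr (- 1 / \<tau>)))
      else if \<tau> > 0 then 0
      else 1)"

definition is_evd :: "real \<Rightarrow> (real \<Rightarrow> real) \<Rightarrow> bool" where
  "is_evd \<tau> H \<longleftrightarrow> (\<exists>m \<sigma>. \<sigma> > 0 \<and> (\<forall>x. H x = std_evd \<tau> ((x - m) / \<sigma>)))"

text \<open>
  Membership depends only on \<open>F\<close>: the law of the maxima is determined by \<open>F\<close>, and every
  distribution function is realised by the coordinates of a product measure on
  \<^typ>\<open>nat \<Rightarrow> real\<close>, so fixing this sample space loses no generality. The term
  for \<open>n = 0\<close> (maximum of the empty set) does not affect the limit.
\<close>

definition max_DA :: "(real \<Rightarrow> real) \<Rightarrow> (real \<Rightarrow> real) set" where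
  "max_DA H =
     {F. \<exists>(M :: (nat \<Rightarrow> real) measure) X c d.
           iid_with_df M X F \<and>
           (\<forall>n. d n > 0) \<and>
           weak_conv (\<lambda>n. left_df M (\<lambda>\<omega>. (Max ((\<lambda>i. X i \<omega>) ` {1..n}) - c n) / d n)) H}"

definition r1_star ::
  "(real \<Rightarrow> real) \<Rightarrow> nat \<Rightarrow> real \<Rightarrow> real \<Rightarrow> real \<Rightarrow> real \<Rightarrow> real \<Rightarrow> real" where
  "r1_star F n l a b q x =
     2 * l^2 * (1 - F (a + b * x))^2 / real n
     + 2 * l^4 * (1 - F (a + b * x))^4 / ((real n)^2 * (1 - q))"

definition r2_star ::
  "(real \<Rightarrow> real) \<Rightarrow> (real \<Rightarrow> real) \<Rightarrow> real \<Rightarrow> real \<Rightarrow> real \<Rightarrow> real \<Rightarrow> real \<Rightarrow> real" where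
  "r2_star F H l a b s x =
     \<bar>l * (1 - F (a + b * x)) + ln (H x)\<bar>
     + (l * (1 - F (a + b * x)) + ln (H x))^2 / (2 * (1 - s))"

end

theory Submission imports Defs begin

text \<open>
  Conditioning on \<open>B\<close> and the binomial theorem give the probability as \<open>(1 - u) ^ n\<close> with
  \<open>u = p * (1 - F (a + b * x))\<close>. Writing it as \<open>H x * exp (- R) * exp (- v)\<close> with
  \<open>R = - n * (ln (1 - u) + u)\<close> and \<open>v = n * u + ln (H x)\<close>, it remains to bound the distance
  of both exponentials from \<open>1\<close>.
\<close>

text \<open>Each induction step multiplies the factorial by \<open>k + 3\<close>, which is at least
  3. This makes the exponential series comparable with a geometric series of ratio
  \<open>w / 3\<close>.\<close>

lemma two_times_three_power_le_fact: "2 * 3 ^ k \<le> (fact (k + 2) :: real)"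
proof (induction k)
  case 0
  then show ?case by (simp add: fact_2)
next
  case (Suc k)
  have "3 * (2 * 3 ^ k) \<le> real (k + 3) * fact (k + 2)"
    using Suc by (intro mult_mono) auto
  also have "\<dots> = fact (Suc k + 2)"
    by (simp add: algebra_simps)
  finally show ?case by simp
qed

text \<open>From the quadratic term on, the series of \<open>exp w\<close> is dominated by the
  geometric series with first term \<open>w^2 / 2\<close> and ratio \<open>w / 3\<close>. The
  condition \<open>w \<le> 3 * s\<close> bounds this ratio by \<open>s\<close>, whence the factor
  \<open>1 / (1 - s)\<close>.\<close>

lemma exp_le_quadratic:
  fixes w s :: real
  assumes "0 \<le> w" "w \<le> 3 * s" "s < 1"
  shows "exp w \<le> 1 + w + w\<^sup>2 / (2 * (1 - s))"
proof -
  have s: "0 \<le> s" using assms by simp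
  have geo: "(\<lambda>k. w\<^sup>2 / 2 * s ^ k) sums (w\<^sup>2 / 2 * (1 / (1 - s)))"
    using s assms by (intro sums_mult geometric_sums) auto
  have le: "inverse (fact (k + 2)) * w ^ (k + 2) \<le> w\<^sup>2 / 2 * s ^ k" for k
  proof -
    have "inverse (fact (k + 2)) * w ^ (k + 2) \<le> inverse (2 * 3 ^ k) * w ^ (k + 2)"
      using two_times_three_power_le_fact[of k] assms
      by (intro mult_right_mono le_imp_inverse_le) auto
    also have "\<dots> = w\<^sup>2 / 2 * (w / 3) ^ k"
      by (simp add: power_add power_divide divide_simps power2_eq_square)
    also have "\<dots> \<le> w\<^sup>2 / 2 * s ^ k"
      using assms by (intro mult_left_mono power_mono) auto
    finally show ?thesis .
  qed
  have summ: "summable (\<lambda>k. inverse (fact (k + 2)) * w ^ (k + 2))"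
    by (rule summable_comparison_test'[OF sums_summable[OF geo], of 0])
      (use le assms in \<open>auto simp: abs_mult\<close>)
  have "exp w = 1 + w + (\<Sum>k. inverse (fact (k + 2)) * w ^ (k + 2))"
    using exp_first_two_terms[of w] by simp
  also have "\<dots> \<le> 1 + w + w\<^sup>2 / 2 * (1 / (1 - s))"
    using suminf_le[OF le summ sums_summable[OF geo]] sums_unique[OF geo] by simp
  finally show ?thesis by (simp add: field_simps)
qed

lemma abs_exp_minus_one_le_quadratic:
  fixes w s :: real
  assumes "\<bar>w\<bar> \<le> 3 * s" "s < 1"
  shows "\<bar>exp w - 1\<bar> \<le> \<bar>w\<bar> + w\<^sup>2 / (2 * (1 - s))"
proof (cases "0 \<le> w")
  case True
  then show ?thesis using exp_le_quadratic[of w s] assms by simp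
next
  \<comment> \<open>For negative \<open>w\<close>, the bounds
    \<open>1 + w \<le> exp w \<le> 1\<close> already give the error
    \<open>\<bar>w\<bar>\<close>.\<close>
  case False
  have "0 \<le> w\<^sup>2 / (2 * (1 - s))" using assms by simp
  moreover have "exp w \<le> 1" using False by simp
  ultimately show ?thesis using False exp_ge_add_one_self[of w] by linarith
qed

text \<open>Expanding the product around 1 gives the two separate errors and their product; this is
  the source of the shape \<open>r1 + r2 + r1 * r2\<close> in the final bound.\<close>

lemma abs_mult_minus_one_le:
  fixes y z c d :: real
  assumes "\<bar>y - 1\<bar> \<le> c" "\<bar>z - 1\<bar> \<le> d"
  shows "\<bar>y * z - 1\<bar> \<le> c + d + c * d"
proof -
  have "y * z - 1 = (y - 1) + (z - 1) + (y - 1) * (z - 1)" by (simp add: algebra_simps)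
  then have "\<bar>y * z - 1\<bar> \<le> \<bar>y - 1\<bar> + \<bar>z - 1\<bar> + \<bar>y - 1\<bar> * \<bar>z - 1\<bar>"
    unfolding abs_mult[symmetric] by linarith
  also have "\<dots> \<le> c + d + c * d"
    using assms by (intro add_mono mult_mono) auto
  finally show ?thesis .
qed

text \<open>The factor is \<open>z = exp (- R)\<close>. For \<open>u\<close> in
  \<open>[0, 1/2]\<close> the logarithm satisfies
  \<open>- u - 2 * u^2 \<le> ln (1 - u) \<le> - u\<close>, so \<open>R\<close> lies between 0 and
  \<open>2 * n * u^2\<close>.\<close>

lemma one_minus_power_approx_exp:
  fixes u :: real
  assumes "0 \<le> u" "u \<le> 1 / 2"
  obtains z where "(1 - u) ^ n = z * exp (- (real n * u))" "\<bar>z - 1\<bar> \<le> 2 * real n * u\<^sup>2"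
proof
  define R where "R = - (real n * (ln (1 - u) + u))"
  have "ln (1 - u) \<le> - u" using ln_le_minus_one[of "1 - u"] assms by simp
  then have R0: "0 \<le> R" unfolding R_def
    by (simp add: mult_nonneg_nonpos)
  have "- u - 2 * u\<^sup>2 \<le> ln (1 - u)" using ln_one_minus_pos_lower_bound assms by blast
  then have "real n * (- (ln (1 - u) + u)) \<le> real n * (2 * u\<^sup>2)"
    by (intro mult_left_mono) auto
  then have "R \<le> 2 * real n * u\<^sup>2" unfolding R_def by (simp add: algebra_simps)
  \<comment> \<open>As \<open>R\<close> is nonnegative, the distance is
    \<open>1 - exp (- R)\<close>, which is at most \<open>R\<close>.\<close>
  then show "\<bar>exp (- R) - 1\<bar> \<le> 2 * real n * u\<^sup>2"
    using R0 exp_ge_add_one_self[of "- R"] by simp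
  have "(1 - u) ^ n = exp (real n * ln (1 - u))"
    using assms by (simp add: exp_of_nat_mult)
  also have "\<dots> = exp (- R) * exp (- (real n * u))"
    by (simp add: R_def exp_add[symmetric] algebra_simps)
  finally show "(1 - u) ^ n = exp (- R) * exp (- (real n * u))" .
qed

text \<open>For \<open>N = 0\<close> both sides are true: the maximum is minus infinity and the
  quantifier ranges over the empty set.\<close>

lemma max_upto_less_iff: "max_upto u N < ereal y \<longleftrightarrow> (\<forall>i\<in>{1..N}. u i < y)"
  by (cases "N = 0") (auto simp: max_upto_def)

text \<open>This is the probability generating function of the binomial distribution, obtained from
  the binomial theorem.\<close>

lemma sum_binomial_pmf_times_power:
  assumes "0 \<le> p" "p \<le> 1"
  shows "(\<Sum>k\<le>n. pmf (binomial_pmf n p) k * t ^ k) = (1 - p * (1 - t)) ^ n"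
proof -
  have "(1 - p * (1 - t)) ^ n = (p * t + (1 - p)) ^ n" by (simp add: algebra_simps)
  also have "\<dots> = (\<Sum>k\<le>n. real (n choose k) * (p * t) ^ k * (1 - p) ^ (n - k))"
    by (rule binomial_ring)
  also have "\<dots> = (\<Sum>k\<le>n. pmf (binomial_pmf n p) k * t ^ k)"
    using assms by (intro sum.cong) (auto simp: power_mult_distrib)
  finally show ?thesis ..
qed

lemma iid_all_less:
  assumes "iid_with_df M X F"
  shows "measure M {\<omega> \<in> space M. \<forall>i\<in>{1..k}. X i \<omega> < y} = F y ^ k"
proof -
  interpret prob_space M using assms by (simp add: iid_with_df_def)
  have ind: "indep_vars (\<lambda>_. borel) X {1..}" and F: "\<And>i. 1 \<le> i \<Longrightarrow> left_df M (X i) = F"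
    using assms by (auto simp: iid_with_df_def)
  show ?thesis
  \<comment> \<open>The empty index set is treated apart, since an intersection over it would be
    \<open>UNIV\<close> instead of \<open>space M\<close>.\<close>
  proof (cases "k = 0")
    case True
    then show ?thesis by (simp add: prob_space)
  next
    case False
    have "indep_vars (\<lambda>_. borel) X {1..k}"
      by (rule indep_vars_subset[OF ind]) auto
    then have "prob (\<Inter>i\<in>{1..k}. X i -` {..<y} \<inter> space M) = (\<Prod>i\<in>{1..k}. prob (X i -` {..<y} \<inter> space M))"
      using False by (intro indep_varsD) auto
    also have "\<dots> = (\<Prod>i\<in>{1..k}. F y)"
    proof (rule prod.cong)
      fix i assume "i \<in> {1..k}"
      then have "F y = left_df M (X i) y" using F by simp
      then show "prob (X i -` {..<y} \<inter> space M) = F y"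
        by (simp add: left_df_def vimage_def Int_def conj_commute)
    qed simp
    also have "(\<Inter>i\<in>{1..k}. X i -` {..<y} \<inter> space M) = {\<omega> \<in> space M. \<forall>i\<in>{1..k}. X i \<omega> < y}"
      using False by auto
    finally show ?thesis by simp
  qed
qed

text \<open>The event is the preimage of a measurable cylinder of the product space, so the
  independence of \<open>B\<close> from the sequence applies to it.\<close>

lemma all_less_in_sequence_algebra:
  fixes X :: "nat \<Rightarrow> 'a \<Rightarrow> real"
  shows "{\<omega> \<in> space M. \<forall>i\<in>{1..k}. X i \<omega> < y}
    \<in> sets (vimage_algebra (space M) (\<lambda>\<omega>. \<lambda>i\<in>{1..}. X i \<omega>) (PiM {1..} (\<lambda>_. borel)))"
proof -
  let ?P = "PiM {1 :: nat..} (\<lambda>_. borel :: real measure)"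
  let ?S = "{f \<in> space ?P. \<forall>i\<in>{1..k}. f i < y}"
  have "?S \<in> sets ?P" by measurable
  then have "(\<lambda>\<omega>. \<lambda>i\<in>{1..}. X i \<omega>) -` ?S \<inter> space M
      \<in> sets (vimage_algebra (space M) (\<lambda>\<omega>. \<lambda>i\<in>{1..}. X i \<omega>) ?P)"
    by (rule in_vimage_algebra)
  also have "(\<lambda>\<omega>. \<lambda>i\<in>{1..}. X i \<omega>) -` ?S \<inter> space M = {\<omega> \<in> space M. \<forall>i\<in>{1..k}. X i \<omega> < y}"
    by (auto simp: space_PiM)
  finally show ?thesis .
qed

text \<open>Splitting by the value \<open>k\<close> of \<open>B\<close>, independence gives the
  weight of \<open>k\<close> times \<open>F y ^ k\<close>; the sum is the generating function at
  \<open>F y\<close>.\<close>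

lemma prob_max_upto_binomial_less:
  assumes iid: "iid_with_df M X F"
    and p: "0 \<le> p" "p \<le> 1"
    and B: "B \<in> measurable M (count_space UNIV)"
    and distr: "distr M (count_space UNIV) B = measure_pmf (binomial_pmf n p)"
    and indep: "indep_of_seq M X B"
  shows "measure M {\<omega> \<in> space M. max_upto (\<lambda>i. X i \<omega>) (B \<omega>) < ereal y} = (1 - p * (1 - F y)) ^ n"
proof -
  interpret prob_space M using iid by (simp add: iid_with_df_def)
  define A where "A k = {\<omega> \<in> space M. \<forall>i\<in>{1..k}. X i \<omega> < y}" for k
  define C where "C k = B -` {k} \<inter> space M" for k
  have "indep_vars (\<lambda>_. borel) X {1..}" using iid by (simp add: iid_with_df_def)
  then have X: "X i \<in> borel_measurable M" if "1 \<le> i" for i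
    using that by (auto simp: indep_vars_def)
  have A: "A k \<in> events" for k
    unfolding A_def using X by measurable
  have C: "C k \<in> events" for k
    unfolding C_def using B by (rule measurable_sets) simp
  have pC: "prob (C k) = pmf (binomial_pmf n p) k" for k
  proof -
    have "prob (C k) = measure (distr M (count_space UNIV) B) {k}"
      unfolding C_def using B by (simp add: measure_distr)
    then show ?thesis by (simp add: distr pmf.rep_eq)
  qed
  have pAC: "prob (A k \<inter> C k) = pmf (binomial_pmf n p) k * F y ^ k" for k
  proof -
    have "C k \<in> sets (vimage_algebra (space M) B (count_space UNIV))"
      unfolding C_def by (rule in_vimage_algebra) simp
    then have "prob (A k \<inter> C k) = prob (A k) * prob (C k)"
      using indep all_less_in_sequence_algebra[of M k X y]
      unfolding indep_of_seq_def A_def by (intro indep_setD)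
    then show ?thesis using iid_all_less[OF iid, of k y] pC by (simp add: A_def)
  qed
  \<comment> \<open>\<open>B\<close> is bounded by \<open>n\<close> only almost surely, so the event
    agrees with the finite union over \<open>k \<le> n\<close> up to a null set.\<close>
  have "AE k in distr M (count_space UNIV) B. k \<le> n"
    unfolding distr AE_measure_pmf_iff using p set_pmf_binomial_eq[of p n] by (auto split: if_splits)
  then have "AE \<omega> in M. B \<omega> \<le> n"
    using B by (simp add: AE_distr_iff)
  then have "prob {\<omega> \<in> space M. max_upto (\<lambda>i. X i \<omega>) (B \<omega>) < ereal y} = prob (\<Union>k\<in>{..n}. A k \<inter> C k)"
  proof (intro finite_measure_eq_AE)
    \<comment> \<open>Over all \<open>k\<close> the decomposition is an exact equality of sets,
      which yields measurability.\<close>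
    have "{\<omega> \<in> space M. max_upto (\<lambda>i. X i \<omega>) (B \<omega>) < ereal y} = (\<Union>k. A k \<inter> C k)"
      by (auto simp: max_upto_less_iff A_def C_def)
    then show "{\<omega> \<in> space M. max_upto (\<lambda>i. X i \<omega>) (B \<omega>) < ereal y} \<in> events"
      using A C by auto
  qed (use A C in \<open>auto simp: max_upto_less_iff A_def C_def\<close>)
  also have "\<dots> = (\<Sum>k\<le>n. prob (A k \<inter> C k))"
    using A C by (intro finite_measure_finite_Union) (auto simp: disjoint_family_on_def C_def)
  also have "\<dots> = (1 - p * (1 - F y)) ^ n"
    unfolding pAC using p by (rule sum_binomial_pmf_times_power)
  finally show ?thesis .
qed

theorem theorem6:
  fixes M :: "'a measure"
    and X :: "nat \<Rightarrow> 'a \<Rightarrow> real"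
    and B :: "'a \<Rightarrow> nat"
    and F H :: "real \<Rightarrow> real"
    and n :: nat
    and p l \<tau> a b x q s :: real
  assumes "iid_with_df M X F"
    and "is_evd \<tau> H"
    and "F \<in> max_DA H"
    and "n \<ge> 1"
    and "0 \<le> p" and "p \<le> 1"
    and "l = real n * p"
    and "B \<in> measurable M (count_space UNIV)"
    and "distr M (count_space UNIV) B = measure_pmf (binomial_pmf n p)"
    and "indep_of_seq M X B"
    and "b > 0"
    and "H x > 0"
    and "p * (1 - F (a + b * x)) \<le> 1 / 2"
    and "q < 1" and "s < 1"
    and "2 * l^2 * (1 - F (a + b * x))^2 / (3 * real n) \<le> q"
    and "\<bar>l * (1 - F (a + b * x)) + ln (H x)\<bar> \<le> 3 * s"
  shows "\<bar>measure M {\<omega> \<in> space M. max_upto (\<lambda>i. X i \<omega>) (B \<omega>) < ereal (a + b * x)} - H x\<bar>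
         \<le> H x * (r1_star F n l a b q x + r2_star F H l a b s x
                  + r1_star F n l a b q x * r2_star F H l a b s x)"
proof -
  define u where "u = p * (1 - F (a + b * x))"
  define v where "v = real n * u + ln (H x)"
  interpret prob_space M using assms(1) by (simp add: iid_with_df_def)
  \<comment> \<open>As a probability, \<open>F (a + b * x)\<close> is at most 1; hence
    \<open>u\<close> is nonnegative.\<close>
  have "F = left_df M (X 1)" using assms(1) by (simp add: iid_with_df_def)
  then have "F (a + b * x) \<le> 1" by (simp add: left_df_def)
  then have u: "0 \<le> u" "u \<le> 1 / 2" using assms(5,13) by (auto simp: u_def)
  have lu: "l * (1 - F (a + b * x)) = real n * u" by (simp add: u_def assms(7))
  obtain z where z: "(1 - u) ^ n = z * exp (- (real n * u))" "\<bar>z - 1\<bar> \<le> 2 * real n * u\<^sup>2"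
    using one_minus_power_approx_exp[OF u] .
  have "2 * l\<^sup>2 * (1 - F (a + b * x))\<^sup>2 / real n = 2 * (real n * u)\<^sup>2 / real n"
    unfolding lu[symmetric] by (simp add: power_mult_distrib)
  also have "\<dots> = 2 * real n * u\<^sup>2"
    using assms(4) by (simp add: power2_eq_square)
  \<comment> \<open>The left side is the first summand of \<open>r1_star\<close>; the second is
    nonnegative because \<open>q < 1\<close>.\<close>
  finally have "2 * real n * u\<^sup>2 \<le> r1_star F n l a b q x"
    using assms(14) by (simp add: r1_star_def)
  with z have r1: "\<bar>z - 1\<bar> \<le> r1_star F n l a b q x" by simp
  have "\<bar>v\<bar> \<le> 3 * s" using assms(17) by (simp add: v_def lu)
  \<comment> \<open>The estimate is applied to \<open>- v\<close>; it involves only the absolute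
    value and the square, so the sign disappears.\<close>
  then have r2: "\<bar>exp (- v) - 1\<bar> \<le> r2_star F H l a b s x"
    using abs_exp_minus_one_le_quadratic[of "- v" s] assms(15)
    by (simp add: r2_star_def lu flip: v_def)
  have "exp (- (real n * u)) = exp (ln (H x)) * exp (- v)"
    unfolding exp_add[symmetric] by (simp add: v_def)
  also have "\<dots> = H x * exp (- v)" using assms(12) by simp
  finally have "exp (- (real n * u)) = H x * exp (- v)" .
  \<comment> \<open>Factoring out \<open>H x\<close> leaves a product of two factors close to 1,
    with errors bounded by \<open>r1\<close> and \<open>r2\<close>.\<close>
  then have "(1 - u) ^ n - H x = H x * (z * exp (- v) - 1)"
    by (simp add: z algebra_simps)
  moreover have "measure M {\<omega> \<in> space M. max_upto (\<lambda>i. X i \<omega>) (B \<omega>) < ereal (a + b * x)} = (1 - u) ^ n"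
    unfolding u_def using assms by (intro prob_max_upto_binomial_less)
  ultimately show ?thesis
    using abs_mult_minus_one_le[OF r1 r2] assms(12) by (simp add: abs_mult)
qed

end
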